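(* Let $X$ be a real Banach space with $\dim X\geqslant 2$. Then for every $t\in[0,\tfrac12)$, $$2t^2-2t+1\leqslant L_X(t)\leqslant 2t^2-4t+2 .$$
   Context: For $x,y$ in a real Banach space $X$, isosceles orthogonality $x\perp_I y$ means $\|x+y\|=\|x-y\|$. For $0\leqslant t<\frac12$ define $$L_X(t)=\sup\left\{\frac{\|tx+(1-t)y\|^2+\|(1-t)x+ty\|^2}{\|x+y\|^2}: x,y\in X,\ (x,y)\neq(0,0),\ x\perp_I y\right\}.$$ *)

theory Defs
  imports Complex_Main "HOL-Library.Extended_Real"
begin

definition isosceles_orth :: "'a::real_normed_vector \<Rightarrow> 'a \<Rightarrow> bool" where
  "isosceles_orth x y \<longleftrightarrow> norm (x + y) = norm (x - y)"

text \<open>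
  The supremum is taken in the extended reals, so that it is the true least upper bound and an
  upper estimate for it includes its finiteness. The denominator never vanishes: if
  \<open>x + y = 0\<close> and \<open>isosceles_orth x y\<close>, then \<open>x - y = 0\<close>, hence \<open>x = 0\<close> and \<open>y = 0\<close>.
\<close>

definition L_const :: "'a::real_normed_vector itself \<Rightarrow> real \<Rightarrow> ereal" where
  "L_const (_ :: 'a itself) t =
     Sup {ereal (((norm (t *\<^sub>R x + (1 - t) *\<^sub>R y))\<^sup>2 + (norm ((1 - t) *\<^sub>R x + t *\<^sub>R y))\<^sup>2)
                   / (norm (x + y))\<^sup>2)
          | x y :: 'a. (x, y) \<noteq> (0, 0) \<and> isosceles_orth x y}"

text \<open>
  The library constant \<open>dim\<close> is \<open>0\<close> on infinite-dimensional spaces, which have to be included here.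
\<close>

definition dim_ge_2 :: "'a::real_vector itself \<Rightarrow> bool" where
  "dim_ge_2 (_ :: 'a itself) \<longleftrightarrow> (\<exists>B :: 'a set. independent B \<and> card B = 2)"

end

theory Submission
  imports Defs
begin

text \<open>
  With \<open>u = x + y\<close>, \<open>v = x - y\<close>, isosceles orthogonality says \<open>norm u = norm v\<close>, and the two
  vectors in the numerator are \<open>(u \<plusminus> (1 - 2 * t) v) / 2\<close>, so that the triangle inequality bounds
  the norm of each by \<open>(1 - t) * norm u\<close>. The lower bound is attained at the trivial pair \<open>y = 0\<close>.
\<close>

text \<open>Orthogonality turns \<open>x + y = 0\<close> into \<open>x - y = 0\<close>. This keeps
  the denominator in \<open>L_const\<close> positive for every admissible pair.\<close>

lemma isosceles_orth_add_eq_0: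
  assumes "isosceles_orth x y" and "x + y = 0"
  shows "x = 0 \<and> y = 0"
proof -
  have "x - y = 0"
    using assms by (simp add: isosceles_orth_def)
  then have "x = y" by simp
  with assms(2) have "2 *\<^sub>R y = 0" by (simp add: scaleR_2)
  with \<open>x = y\<close> show ?thesis by simp
qed

lemma isosceles_orth_commute: "isosceles_orth x y \<longleftrightarrow> isosceles_orth y x"
  by (simp add: isosceles_orth_def add.commute norm_minus_commute)

lemma norm_convex_combination_isosceles_orth_le:
  fixes x y :: "'a::real_normed_vector"
  assumes "isosceles_orth x y" and "t \<le> 1 / 2"
  shows "norm (t *\<^sub>R x + (1 - t) *\<^sub>R y) \<le> (1 - t) * norm (x + y)"
proof -
  have "t *\<^sub>R x + (1 - t) *\<^sub>R y = (1 / 2) *\<^sub>R (x + y) - (1 / 2 - t) *\<^sub>R (x - y)"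
    by (simp add: algebra_simps flip: scaleR_add_left)
  also have "norm \<dots> \<le> norm ((1 / 2) *\<^sub>R (x + y)) + norm ((1 / 2 - t) *\<^sub>R (x - y))"
    by (rule norm_triangle_ineq4)
  \<comment> \<open>Orthogonality replaces \<open>norm (x - y)\<close> by
    \<open>norm (x + y)\<close>; as \<open>t \<le> 1 / 2\<close>, the scalar
    \<open>1 / 2 - t\<close> is its own absolute value.\<close>
  also have "\<dots> = (1 / 2) * norm (x + y) + (1 / 2 - t) * norm (x + y)"
    using assms by (simp add: isosceles_orth_def)
  also have "\<dots> = (1 - t) * norm (x + y)"
    by (simp add: algebra_simps)
  finally show ?thesis .
qed

lemma dim_ge_2_imp_nonzero:
  assumes "dim_ge_2 TYPE('a::real_vector)"
  obtains x :: "'a::real_vector" where "x \<noteq> 0"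
proof -
  obtain B :: "'a set" where "independent B" "card B = 2"
    using assms by (auto simp: dim_ge_2_def)
  then obtain x where "x \<in> B" by fastforce
  with \<open>independent B\<close> have "x \<noteq> 0"
    using dependent_zero by blast
  then show thesis by (rule that)
qed

theorem proposition1:
  fixes t :: real
  assumes "dim_ge_2 TYPE('a::banach)"
    and "0 \<le> t" and "t < 1 / 2"
  shows "ereal (2 * t\<^sup>2 - 2 * t + 1) \<le> L_const TYPE('a) t
       \<and> L_const TYPE('a) t \<le> ereal (2 * t\<^sup>2 - 4 * t + 2)"
proof
  obtain x :: 'a where "x \<noteq> 0"
    using dim_ge_2_imp_nonzero[OF assms(1)] .
  \<comment> \<open>At the pair \<open>(x, 0)\<close> the factor \<open>(norm x)\<^sup>2\<close>
    cancels, which leaves \<open>t\<^sup>2 + (1 - t)\<^sup>2\<close>.\<close>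
  have "2 * t\<^sup>2 - 2 * t + 1 =
      ((norm (t *\<^sub>R x + (1 - t) *\<^sub>R 0))\<^sup>2 + (norm ((1 - t) *\<^sub>R x + t *\<^sub>R 0))\<^sup>2) / (norm (x + 0))\<^sup>2"
    using \<open>x \<noteq> 0\<close>
    by (simp add: power_mult_distrib flip: distrib_right)
      (simp add: power2_eq_square algebra_simps)
  moreover have "isosceles_orth x 0"
    by (simp add: isosceles_orth_def)
  ultimately show "ereal (2 * t\<^sup>2 - 2 * t + 1) \<le> L_const TYPE('a) t"
    unfolding L_const_def using \<open>x \<noteq> 0\<close>
    by (intro Sup_upper CollectI exI[of _ x] exI[of _ 0]) simp
next
  have "((norm (t *\<^sub>R x + (1 - t) *\<^sub>R y))\<^sup>2 + (norm ((1 - t) *\<^sub>R x + t *\<^sub>R y))\<^sup>2) / (norm (x + y))\<^sup>2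
      \<le> 2 * t\<^sup>2 - 4 * t + 2"
    if "(x, y) \<noteq> (0, 0)" and orth: "isosceles_orth x y" for x y :: 'a
  proof -
    have pos: "0 < (norm (x + y))\<^sup>2"
      using that isosceles_orth_add_eq_0 by fastforce
    have "norm (t *\<^sub>R x + (1 - t) *\<^sub>R y) \<le> (1 - t) * norm (x + y)"
      using orth assms(3) by (intro norm_convex_combination_isosceles_orth_le) auto
    \<comment> \<open>Swapping \<open>x\<close> and \<open>y\<close> carries the first vector of the
      numerator to the second, and orthogonality is symmetric.\<close>
    moreover have "norm ((1 - t) *\<^sub>R x + t *\<^sub>R y) \<le> (1 - t) * norm (x + y)"
      using norm_convex_combination_isosceles_orth_le[of y x t] orth assms(3)
      by (simp add: isosceles_orth_commute add.commute)
    ultimately have "(norm (t *\<^sub>R x + (1 - t) *\<^sub>R y))\<^sup>2 + (norm ((1 - t) *\<^sub>R x + t *\<^sub>R y))\<^sup>2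
        \<le> ((1 - t) * norm (x + y))\<^sup>2 + ((1 - t) * norm (x + y))\<^sup>2"
      by (intro add_mono power_mono) auto
    also have "\<dots> = (2 * t\<^sup>2 - 4 * t + 2) * (norm (x + y))\<^sup>2"
      by (simp add: power2_eq_square algebra_simps)
    \<comment> \<open>The upper bound is \<open>2 * (1 - t)\<^sup>2\<close>, one
      \<open>(1 - t)\<^sup>2\<close> from each vector; \<open>pos\<close> permits clearing the
      denominator.\<close>
    finally show ?thesis
      using pos by (simp add: pos_divide_le_eq)
  qed
  then show "L_const TYPE('a) t \<le> ereal (2 * t\<^sup>2 - 4 * t + 2)"
    unfolding L_const_def by (intro Sup_least) auto
qed

end
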